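(* Let $R$ be a commutative ring with $1\neq 0$, let $\tau$ be a symmetric relation on $R^{\#}$, and let $\tau_{\mathrm{reg}}:=\tau\cap(\mathrm{Reg}(R)\times\mathrm{Reg}(R))$. Let $\alpha\in\{$atomic, strongly atomic, m-atomic, unrefinably atomic$\}$ and $\beta\in\{$associate, strongly associate$\}$. Then the following hold. (1) $R$ satisfies $\tau$-regular-ACCP if and only if $R$ satisfies $\tau_{\mathrm{reg}}$-ACCP. (2) $R$ is a $\tau$-regular-UFR if and only if $R$ is a $\tau_{\mathrm{reg}}$-$\alpha$-$\beta$-UFR. (3) $R$ is a $\tau$-regular-HFR if and only if $R$ is a $\tau_{\mathrm{reg}}$-$\alpha$-HFR. (4) $R$ is a $\tau$-regular-BFR if and only if $R$ is a $\tau_{\mathrm{reg}}$-BFR. (5) $R$ is a $\tau$-regular-idf ring if and only if $R$ is a $\tau_{\mathrm{reg}}$-$\alpha$-$\beta$-df ring. (6) $R$ is a $\tau$-regular-atomic $\tau$-regular-idf ring if and only if $R$ is a $\tau_{\mathrm{reg}}$-$\alpha$, $\tau_{\mathrm{reg}}$-$\alpha$-$\beta$-df ring. (7) $R$ is a $\tau$-regular-WFFR if and only if $R$ is a $\tau_{\mathrm{reg}}$-$\beta$-WFFR. (8) $R$ is a $\tau$-regular-FFR if and only if $R$ is a $\tau_{\mathrm{reg}}$-$\beta$-FFR. Moreover, if $\tau$ is refinable, then the properties of $R$ appearing in (6), (7) and (8) are all equivalent to one another.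
   Context: $U(R)$ is the group of units of $R$, $R^{\#}$ the set of nonzero non-units, $\mathrm{Reg}(R)$ the set of regular elements (non-zero-divisors), $\mathrm{Reg}(R)^{\#}$ the set of regular non-units. $a\sim b$ ($a,b$ associate) means $(a)=(b)$; $a\approx b$ (strongly associate) means $a=\lambda b$ for some $\lambda\in U(R)$. For any symmetric relation $\sigma$ on $R^{\#}$ (the definitions below are applied to $\sigma=\tau$ and $\sigma=\tau_{\mathrm{reg}}$): a $\sigma$-factorization of a non-unit $a$ is an expression $a=\lambda a_1\cdots a_n$, $n\ge1$, $\lambda\in U(R)$, each $a_i$ a non-unit, $a_i\,\sigma\,a_j$ for all $i\ne j$; it is trivial if $n=1$. The $a_i$ are its $\sigma$-factors, or $\sigma$-divisors of $a$, and $b\mid_\sigma a$ means $b$ is a $\sigma$-factor in some $\sigma$-factorization of $a$; a non-trivial $\sigma$-divisor is a factor of a non-trivial $\sigma$-factorization. $\sigma$ is refinable if, whenever $\lambda a_1\cdots a_n$ and $a_i=\lambda_ib_{i1}\cdots b_{im_i}$ ($1\le i\le n$) are $\sigma$-factorizations, so is $(\lambda\lambda_1\cdots\lambda_n)b_{11}\cdots b_{1m_1}\cdots b_{n1}\cdots b_{nm_n}$. A non-unit $a$ is $\sigma$-atomic (resp. $\sigma$-strongly atomic, $\sigma$-m-atomic) if for every $\sigma$-factorization $a=\lambda a_1\cdots a_n$ one has $a\sim a_i$ for some $i$ (resp. $a\approx a_i$ for some $i$, $a\sim a_i$ for all $i$); $a$ is $\sigma$-unrefinably atomic if it has only trivial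 $\sigma$-factorizations. A $\sigma$-$\alpha$-factorization is a $\sigma$-factorization all of whose factors are $\sigma$-$\alpha$. $R$ is $\sigma$-$\alpha$ if every non-unit has a $\sigma$-$\alpha$-factorization. $R$ satisfies $\sigma$-ACCP if every chain $(a_0)\subseteq(a_1)\subseteq\cdots$ with $a_{i+1}\mid_\sigma a_i$ for all $i$ is eventually constant. $R$ is a $\sigma$-$\alpha$-HFR if it is $\sigma$-$\alpha$ and any two $\sigma$-$\alpha$-factorizations of the same non-unit have the same length; it is a $\sigma$-$\alpha$-$\beta$-UFR if moreover the factors can be rearranged so that corresponding ones are $\beta$. $R$ is a $\sigma$-BFR if for every non-unit $a$ there is $N(a)\in\mathbb N$ bounding the length of every $\sigma$-factorization of $a$. $R$ is a $\sigma$-$\beta$-FFR if every non-unit has only finitely many non-trivial $\sigma$-factorizations up to rearrangement and $\beta$. $R$ is a $\sigma$-$\beta$-WFFR if every non-unit has only finitely many non-trivial $\sigma$-divisors up to $\beta$. $R$ is a $\sigma$-$\alpha$-$\beta$-df ring if every non-unit has only finitely many $\sigma$-$\alpha$ $\sigma$-divisors up to $\beta$. $\tau$-regular (also written $\tau$-$r$-) notions: a $\tau$-regular-factorization is a $\tau$-factorization of an element of $\mathrm{Reg}(R)$. A regular non-unit $a$ is $\tau$-$r$-irreducible if for every $\tau$-regular-factorization $a=\lambda a_1\cdots a_n$ one has $a\sim a_i$ for some $i$ (equivalently, it has only trivial ones). $R$ is $\tau$-regular-atomic if every $a\in\mathrm{Reg}(R)^{\#}$ has a $\tau$-regular-factorization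 into $\tau$-$r$-irreducibles (a $\tau$-$r$-atomic factorization). $R$ satisfies $\tau$-regular-ACCP if there is no infinite chain $(a_1)\subsetneq(a_2)\subsetneq\cdots$ with all $a_i$ regular and $a_{i+1}$ a $\tau$-factor in some $\tau$-regular-factorization of $a_i$. $R$ is a $\tau$-regular-HFR if it is $\tau$-regular-atomic and any two $\tau$-$r$-atomic factorizations of the same element have the same length; a $\tau$-regular-UFR if moreover the factors can be rearranged to be pairwise associate. $R$ is a $\tau$-regular-BFR if for each $a\in\mathrm{Reg}(R)$ there is a bound on the lengths of $\tau$-regular-factorizations of $a$. $R$ is a $\tau$-regular-idf ring if each $a\in\mathrm{Reg}(R)^{\#}$ has only finitely many $\tau$-$r$-irreducible $\tau$-divisors up to associates; a $\tau$-regular-WFFR if each $a\in\mathrm{Reg}(R)^{\#}$ has only finitely many $\tau$-divisors up to associates; a $\tau$-regular-FFR if each $a\in\mathrm{Reg}(R)^{\#}$ has only finitely many $\tau$-factorizations up to order and associates. *)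

theory Defs
  imports "HOL-Library.Multiset"
begin

text \<open>The ring \<open>R\<close> is the type \<open>'a :: comm_ring_1\<close> (so \<open>0 \<noteq> 1\<close>), and properties of \<open>R\<close> relative to a
  relation \<open>\<sigma>\<close> are predicates on \<open>\<sigma> :: ('a \<times> 'a) set\<close>.\<close>

abbreviation ring_unit :: "'a::comm_ring_1 \<Rightarrow> bool" where
  "ring_unit a \<equiv> a dvd 1"

definition nonzero_nonunits :: "'a::comm_ring_1 set" where
  "nonzero_nonunits = {a. a \<noteq> 0 \<and> \<not> ring_unit a}"

definition Reg :: "'a::comm_ring_1 set" where
  "Reg = {a. \<forall>x. a * x = 0 \<longrightarrow> x = 0}"

definition Reg_nonunits :: "'a::comm_ring_1 set" where
  "Reg_nonunits = {a \<in> Reg. \<not> ring_unit a}"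

definition principal :: "'a::comm_ring_1 \<Rightarrow> 'a set" where
  "principal a = {r * a | r. True}"

definition associate :: "'a::comm_ring_1 \<Rightarrow> 'a \<Rightarrow> bool" where
  "associate a b \<longleftrightarrow> principal a = principal b"

definition strongly_associate :: "'a::comm_ring_1 \<Rightarrow> 'a \<Rightarrow> bool" where
  "strongly_associate a b \<longleftrightarrow> (\<exists>u. ring_unit u \<and> a = u * b)"

definition reg_restrict :: "('a::comm_ring_1 \<times> 'a) set \<Rightarrow> ('a \<times> 'a) set" where
  "reg_restrict \<tau> = \<tau> \<inter> (Reg \<times> Reg)"

text \<open>\<open>factorization \<sigma> a u as\<close>: the expression \<open>a = u * a\<^sub>1 * \<dots> * a\<^sub>n\<close>, with \<open>as = [a\<^sub>1, \<dots>, a\<^sub>n]\<close>, is a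
  \<open>\<sigma>\<close>-factorization of the non-unit \<open>a\<close>. The condition is on distinct indices, so a repeated factor
  has to be \<open>\<sigma>\<close>-related to itself, while a factorization of length 1 carries no \<open>\<sigma>\<close>-condition.\<close>

definition factorization ::
  "('a::comm_ring_1 \<times> 'a) set \<Rightarrow> 'a \<Rightarrow> 'a \<Rightarrow> 'a list \<Rightarrow> bool" where
  "factorization \<sigma> a u as \<longleftrightarrow>
     \<not> ring_unit a \<and> ring_unit u \<and> as \<noteq> [] \<and> (\<forall>x\<in>set as. \<not> ring_unit x) \<and>
     (\<forall>i<length as. \<forall>j<length as. i \<noteq> j \<longrightarrow> (as ! i, as ! j) \<in> \<sigma>) \<and>
     a = u * prod_list as"

definition divisor :: "('a::comm_ring_1 \<times> 'a) set \<Rightarrow> 'a \<Rightarrow> 'a \<Rightarrow> bool" where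
  "divisor \<sigma> b a \<longleftrightarrow> (\<exists>u as. factorization \<sigma> a u as \<and> b \<in> set as)"

definition nontrivial_divisor :: "('a::comm_ring_1 \<times> 'a) set \<Rightarrow> 'a \<Rightarrow> 'a \<Rightarrow> bool" where
  "nontrivial_divisor \<sigma> b a \<longleftrightarrow>
     (\<exists>u as. factorization \<sigma> a u as \<and> length as \<noteq> 1 \<and> b \<in> set as)"

definition refinable :: "('a::comm_ring_1 \<times> 'a) set \<Rightarrow> bool" where
  "refinable \<sigma> \<longleftrightarrow>
     (\<forall>a u as us bss. factorization \<sigma> a u as \<and>
        length us = length as \<and> length bss = length as \<and>
        (\<forall>i<length as. factorization \<sigma> (as ! i) (us ! i) (bss ! i)) \<longrightarrow>
        factorization \<sigma> a (u * prod_list us) (concat bss))"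

datatype atom_kind = Atomic | Strongly_Atomic | M_Atomic | Unrefinably_Atomic

datatype assoc_kind = Associate | Strongly_Associate

fun assoc_by :: "assoc_kind \<Rightarrow> 'a::comm_ring_1 \<Rightarrow> 'a \<Rightarrow> bool" where
  "assoc_by Associate a b \<longleftrightarrow> associate a b"
| "assoc_by Strongly_Associate a b \<longleftrightarrow> strongly_associate a b"

fun is_atom :: "atom_kind \<Rightarrow> ('a::comm_ring_1 \<times> 'a) set \<Rightarrow> 'a \<Rightarrow> bool" where
  "is_atom Atomic \<sigma> a \<longleftrightarrow>
     \<not> ring_unit a \<and> (\<forall>u as. factorization \<sigma> a u as \<longrightarrow> (\<exists>x\<in>set as. associate a x))"
| "is_atom Strongly_Atomic \<sigma> a \<longleftrightarrow>
     \<not> ring_unit a \<and> (\<forall>u as. factorization \<sigma> a u as \<longrightarrow> (\<exists>x\<in>set as. strongly_associate a x))"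
| "is_atom M_Atomic \<sigma> a \<longleftrightarrow>
     \<not> ring_unit a \<and> (\<forall>u as. factorization \<sigma> a u as \<longrightarrow> (\<forall>x\<in>set as. associate a x))"
| "is_atom Unrefinably_Atomic \<sigma> a \<longleftrightarrow>
     \<not> ring_unit a \<and> (\<forall>u as. factorization \<sigma> a u as \<longrightarrow> length as = 1)"

text \<open>``Finitely many up to an equivalence \<open>E\<close>'': the set of \<open>E\<close>-classes met by \<open>A\<close> is finite.\<close>

definition finite_up_to :: "('b \<Rightarrow> 'b \<Rightarrow> bool) \<Rightarrow> 'b set \<Rightarrow> bool" where
  "finite_up_to E A \<longleftrightarrow> finite (A // {(x, y). E x y})"

text \<open>Two factorizations, as pairs of the leading unit and the list of factors, agree up to
  rearrangement and \<open>E\<close>; the leading unit is disregarded.\<close>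

definition rearranged_by ::
  "('a \<Rightarrow> 'a \<Rightarrow> bool) \<Rightarrow> 'a \<times> 'a list \<Rightarrow> 'a \<times> 'a list \<Rightarrow> bool" where
  "rearranged_by E p q \<longleftrightarrow> (\<exists>cs. mset cs = mset (snd q) \<and> list_all2 E (snd p) cs)"

definition atom_factorization ::
  "atom_kind \<Rightarrow> ('a::comm_ring_1 \<times> 'a) set \<Rightarrow> 'a \<Rightarrow> 'a \<Rightarrow> 'a list \<Rightarrow> bool" where
  "atom_factorization \<alpha> \<sigma> a u as \<longleftrightarrow> factorization \<sigma> a u as \<and> (\<forall>x\<in>set as. is_atom \<alpha> \<sigma> x)"

definition atomic_ring :: "atom_kind \<Rightarrow> ('a::comm_ring_1 \<times> 'a) set \<Rightarrow> bool" where
  "atomic_ring \<alpha> \<sigma> \<longleftrightarrow> (\<forall>a. \<not> ring_unit a \<longrightarrow> (\<exists>u as. atom_factorization \<alpha> \<sigma> a u as))"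

definition ACCP :: "('a::comm_ring_1 \<times> 'a) set \<Rightarrow> bool" where
  "ACCP \<sigma> \<longleftrightarrow>
     (\<forall>f :: nat \<Rightarrow> 'a.
        (\<forall>i. principal (f i) \<subseteq> principal (f (Suc i)) \<and> divisor \<sigma> (f (Suc i)) (f i)) \<longrightarrow>
        (\<exists>N. \<forall>n\<ge>N. principal (f n) = principal (f N)))"

definition HFR :: "atom_kind \<Rightarrow> ('a::comm_ring_1 \<times> 'a) set \<Rightarrow> bool" where
  "HFR \<alpha> \<sigma> \<longleftrightarrow> atomic_ring \<alpha> \<sigma> \<and>
     (\<forall>a u as v bs. atom_factorization \<alpha> \<sigma> a u as \<and> atom_factorization \<alpha> \<sigma> a v bs \<longrightarrow>
        length as = length bs)"

definition UFR :: "atom_kind \<Rightarrow> assoc_kind \<Rightarrow> ('a::comm_ring_1 \<times> 'a) set \<Rightarrow> bool" where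
  "UFR \<alpha> \<beta> \<sigma> \<longleftrightarrow> HFR \<alpha> \<sigma> \<and>
     (\<forall>a u as v bs. atom_factorization \<alpha> \<sigma> a u as \<and> atom_factorization \<alpha> \<sigma> a v bs \<longrightarrow>
        rearranged_by (assoc_by \<beta>) (u, as) (v, bs))"

definition BFR :: "('a::comm_ring_1 \<times> 'a) set \<Rightarrow> bool" where
  "BFR \<sigma> \<longleftrightarrow>
     (\<forall>a. \<not> ring_unit a \<longrightarrow> (\<exists>N. \<forall>u as. factorization \<sigma> a u as \<longrightarrow> length as \<le> N))"

definition FFR :: "assoc_kind \<Rightarrow> ('a::comm_ring_1 \<times> 'a) set \<Rightarrow> bool" where
  "FFR \<beta> \<sigma> \<longleftrightarrow>
     (\<forall>a. \<not> ring_unit a \<longrightarrow>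
        finite_up_to (rearranged_by (assoc_by \<beta>))
          {(u, as). factorization \<sigma> a u as \<and> length as \<noteq> 1})"

definition WFFR :: "assoc_kind \<Rightarrow> ('a::comm_ring_1 \<times> 'a) set \<Rightarrow> bool" where
  "WFFR \<beta> \<sigma> \<longleftrightarrow>
     (\<forall>a. \<not> ring_unit a \<longrightarrow> finite_up_to (assoc_by \<beta>) {b. nontrivial_divisor \<sigma> b a})"

definition df_ring :: "atom_kind \<Rightarrow> assoc_kind \<Rightarrow> ('a::comm_ring_1 \<times> 'a) set \<Rightarrow> bool" where
  "df_ring \<alpha> \<beta> \<sigma> \<longleftrightarrow>
     (\<forall>a. \<not> ring_unit a \<longrightarrow> finite_up_to (assoc_by \<beta>) {b. divisor \<sigma> b a \<and> is_atom \<alpha> \<sigma> b})"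

definition regular_factorization ::
  "('a::comm_ring_1 \<times> 'a) set \<Rightarrow> 'a \<Rightarrow> 'a \<Rightarrow> 'a list \<Rightarrow> bool" where
  "regular_factorization \<tau> a u as \<longleftrightarrow> a \<in> Reg \<and> factorization \<tau> a u as"

definition regular_irreducible :: "('a::comm_ring_1 \<times> 'a) set \<Rightarrow> 'a \<Rightarrow> bool" where
  "regular_irreducible \<tau> a \<longleftrightarrow> a \<in> Reg_nonunits \<and>
     (\<forall>u as. regular_factorization \<tau> a u as \<longrightarrow> (\<exists>x\<in>set as. associate a x))"

definition regular_atomic_factorization ::
  "('a::comm_ring_1 \<times> 'a) set \<Rightarrow> 'a \<Rightarrow> 'a \<Rightarrow> 'a list \<Rightarrow> bool" where
  "regular_atomic_factorization \<tau> a u as \<longleftrightarrow>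
     regular_factorization \<tau> a u as \<and> (\<forall>x\<in>set as. regular_irreducible \<tau> x)"

definition regular_atomic :: "('a::comm_ring_1 \<times> 'a) set \<Rightarrow> bool" where
  "regular_atomic \<tau> \<longleftrightarrow> (\<forall>a\<in>Reg_nonunits. \<exists>u as. regular_atomic_factorization \<tau> a u as)"

definition regular_ACCP :: "('a::comm_ring_1 \<times> 'a) set \<Rightarrow> bool" where
  "regular_ACCP \<tau> \<longleftrightarrow>
     \<not> (\<exists>f :: nat \<Rightarrow> 'a. \<forall>i. f i \<in> Reg \<and> principal (f i) \<subset> principal (f (Suc i)) \<and>
           (\<exists>u as. regular_factorization \<tau> (f i) u as \<and> f (Suc i) \<in> set as))"

definition regular_HFR :: "('a::comm_ring_1 \<times> 'a) set \<Rightarrow> bool" where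
  "regular_HFR \<tau> \<longleftrightarrow> regular_atomic \<tau> \<and>
     (\<forall>a u as v bs.
        regular_atomic_factorization \<tau> a u as \<and> regular_atomic_factorization \<tau> a v bs \<longrightarrow>
        length as = length bs)"

definition regular_UFR :: "('a::comm_ring_1 \<times> 'a) set \<Rightarrow> bool" where
  "regular_UFR \<tau> \<longleftrightarrow> regular_HFR \<tau> \<and>
     (\<forall>a u as v bs.
        regular_atomic_factorization \<tau> a u as \<and> regular_atomic_factorization \<tau> a v bs \<longrightarrow>
        rearranged_by associate (u, as) (v, bs))"

definition regular_BFR :: "('a::comm_ring_1 \<times> 'a) set \<Rightarrow> bool" where
  "regular_BFR \<tau> \<longleftrightarrow>
     (\<forall>a\<in>Reg. \<exists>N. \<forall>u as. regular_factorization \<tau> a u as \<longrightarrow> length as \<le> N)"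

definition regular_idf :: "('a::comm_ring_1 \<times> 'a) set \<Rightarrow> bool" where
  "regular_idf \<tau> \<longleftrightarrow>
     (\<forall>a\<in>Reg_nonunits. finite_up_to associate {b. divisor \<tau> b a \<and> regular_irreducible \<tau> b})"

definition regular_WFFR :: "('a::comm_ring_1 \<times> 'a) set \<Rightarrow> bool" where
  "regular_WFFR \<tau> \<longleftrightarrow> (\<forall>a\<in>Reg_nonunits. finite_up_to associate {b. divisor \<tau> b a})"

definition regular_FFR :: "('a::comm_ring_1 \<times> 'a) set \<Rightarrow> bool" where
  "regular_FFR \<tau> \<longleftrightarrow>
     (\<forall>a\<in>Reg_nonunits.
        finite_up_to (rearranged_by associate) {(u, as). factorization \<tau> a u as})"

end

theory Submission
  imports Defs
begin

text \<open>
  Write \<open>\<sigma>\<close> for \<open>reg_restrict \<tau>\<close>. The ring properties for \<open>\<sigma>\<close> range over all non-units, the \<open>\<tau>\<close>-regular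
  ones only over regular elements, so the two kinds of elements are compared separately.

  If \<open>a\<close> is regular, then so is every factor of \<open>a\<close>, hence the \<open>\<sigma>\<close>-factorizations of \<open>a\<close> are exactly its
  \<open>\<tau>\<close>-factorizations (\<open>factorization_reg_restrict\<close>). Regular elements can be cancelled, so for them
  associate means strongly associate (\<open>assoc_by_iff_associate\<close>), and a factorization in which one factor
  is an associate of the product is trivial (\<open>factor_associate_imp_trivial\<close>). Therefore the four kinds
  of atoms all coincide with the \<open>\<tau>\<close>-\<open>r\<close>-irreducibles (\<open>is_atom_iff_regular_irreducible\<close>).

  If \<open>a\<close> is not regular, then a \<open>\<sigma>\<close>-factorization with two or more factors is impossible, because \<open>\<sigma>\<close>
  relates only regular elements and these are closed under products
  (\<open>nonregular_factorization_trivial\<close>). Such an \<open>a\<close> is an atom of every kind, has one factor up to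
  strong associates, and so satisfies each finiteness or uniqueness condition for free.

  This settles all the equivalences between \<open>\<tau>\<close>-regular and \<open>\<sigma>\<close>-properties except for the chain
  condition, which needs one extra step: an ascending chain may stay constant for a while, and these
  repetitions have to be skipped. That is harmless because a divisor of an element is also a divisor of
  its strong associates (\<open>divisor_unit_multiple\<close>).

  For the last part, record a factorization by the multiset of principal ideals of its factors, its
  class multiset. By cancellation, the class multisets of the factorizations of one regular element
  form an antichain for inclusion (\<open>class_multiset_not_proper\<close>). An antichain of multisets over a finite
  set is finite, by Dickson's lemma (\<open>finite_multiset_antichain\<close>), so an element whose
  factorizations involve only finitely many classes of factors has only finitely many factorizations.
  This yields that WFFR and FFR agree. If \<open>\<tau>\<close> is refinable, every factorization can be refined: in
  an atomic idf ring, any divisor is up to a unit a partial product of one of the finitely many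
  factorizations into irreducibles, which gives WFFR; and in an FFR lengths are bounded, so that a
  longest factorization must consist of irreducibles, which gives atomicity.
\<close>

section \<open>Regular elements and associates\<close>

lemma principal_subset_iff_dvd:
  fixes a b :: "'a::comm_ring_1"
  shows "principal a \<subseteq> principal b \<longleftrightarrow> b dvd a"
proof -
  have mem: "x \<in> principal c \<longleftrightarrow> c dvd x" for x c :: 'a
    by (auto simp: principal_def dvd_def mult.commute[of c])
  show ?thesis
  proof
    assume "principal a \<subseteq> principal b"
    moreover have "a \<in> principal a" by (simp add: mem)
    ultimately have "a \<in> principal b" by (rule subsetD)
    then show "b dvd a" by (simp add: mem)
  next
    assume "b dvd a"
    then have "x \<in> principal b" if "x \<in> principal a" for x
      using that by (simp only: mem dvd_trans[of b a x])
    then show "principal a \<subseteq> principal b" by (rule subsetI)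
  qed
qed

lemma principal_eq_iff_dvd:
  fixes a b :: "'a::comm_ring_1"
  shows "principal a = principal b \<longleftrightarrow> a dvd b \<and> b dvd a"
  unfolding set_eq_subset principal_subset_iff_dvd by blast

lemma RegI: "(\<And>x. a * x = 0 \<Longrightarrow> x = 0) \<Longrightarrow> a \<in> Reg"
  unfolding Reg_def by blast

lemma RegD: "a \<in> Reg \<Longrightarrow> a * x = 0 \<Longrightarrow> x = 0"
  unfolding Reg_def by blast

lemma Reg_dvd:
  assumes "a \<in> Reg" "b dvd a"
  shows "b \<in> Reg"
proof -
  obtain k where k: "a = b * k" using assms(2) ..
  show ?thesis
  proof (rule RegI)
    fix x assume "b * x = 0"
    then have "(b * x) * k = 0" by simp
    then have "a * x = 0" by (simp add: k mult_ac)
    then show "x = 0" by (rule RegD[OF assms(1)])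
  qed
qed

lemma Reg_one: "1 \<in> Reg"
  by (rule RegI) simp

lemma Reg_mult:
  assumes "a \<in> Reg" "b \<in> Reg"
  shows "a * b \<in> Reg"
proof (rule RegI)
  fix x assume "a * b * x = 0"
  then have "a * (b * x) = 0" by (simp add: mult.assoc)
  then show "x = 0" using assms RegD by blast
qed

lemma Reg_prod_list: "set xs \<subseteq> Reg \<Longrightarrow> prod_list xs \<in> Reg"
  by (induction xs) (auto simp: Reg_one Reg_mult)

lemma Reg_cancel:
  assumes "a \<in> Reg" "a * x = a * y"
  shows "x = y"
proof -
  have "a * (x - y) = 0" using assms(2) by (simp add: right_diff_distrib)
  then have "x - y = 0" by (rule RegD[OF assms(1)])
  then show ?thesis by simp
qed

lemma ring_unit_inverse:
  fixes u :: "'a::comm_ring_1"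
  assumes "ring_unit u"
  obtains v where "ring_unit v" "u * v = 1"
proof -
  obtain v where v: "1 = u * v" using assms ..
  then have "ring_unit v" using dvd_triv_right[of v u] by simp
  with v that show ?thesis by simp
qed

lemma principal_unit_mult:
  fixes u b :: "'a::comm_ring_1"
  assumes "ring_unit u"
  shows "principal (u * b) = principal b"
proof -
  obtain v where "u * v = 1" using assms by (rule ring_unit_inverse)
  then have "b = (u * b) * v" by (simp add: mult_ac)
  then have "u * b dvd b" by (rule dvdI)
  then show ?thesis by (simp add: principal_eq_iff_dvd)
qed

lemma ring_unit_mult:
  fixes u v :: "'a::comm_ring_1"
  shows "ring_unit u \<Longrightarrow> ring_unit v \<Longrightarrow> ring_unit (u * v)"
  using mult_dvd_mono[of u 1 v 1] by simp

lemma strongly_associate_unit_multiples: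
  assumes "ring_unit u" "ring_unit v" "u * b = v * c"
  shows "strongly_associate b c"
proof -
  obtain w where w: "ring_unit w" "u * w = 1" using assms(1) by (rule ring_unit_inverse)
  have "b = (u * w) * b" by (simp add: w)
  also have "\<dots> = w * (u * b)" by (simp add: mult_ac)
  also have "\<dots> = (w * v) * c" by (simp add: assms(3) mult.assoc)
  finally show ?thesis
    unfolding strongly_associate_def using ring_unit_mult[OF w(1) assms(2)] by blast
qed

lemma strongly_associate_imp_assoc_by: "strongly_associate a b \<Longrightarrow> assoc_by \<beta> a b"
  by (cases \<beta>) (auto simp: associate_def strongly_associate_def principal_unit_mult)

lemma assoc_by_class_cong:
  assumes "strongly_associate a b"
  shows "assoc_by \<beta> b y \<longleftrightarrow> assoc_by \<beta> a y"
proof -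
  obtain u where u: "ring_unit u" "a = u * b"
    using assms by (auto simp: strongly_associate_def)
  have pr: "principal a = principal b" using u by (simp add: principal_unit_mult)
  have "strongly_associate b y \<longleftrightarrow> strongly_associate a y"
  proof
    assume "strongly_associate b y"
    then obtain v where "ring_unit v" "b = v * y" by (auto simp: strongly_associate_def)
    then have "ring_unit (u * v)" "a = (u * v) * y"
      using u by (simp_all add: ring_unit_mult mult.assoc)
    then show "strongly_associate a y" unfolding strongly_associate_def by blast
  next
    assume "strongly_associate a y"
    then obtain v where "ring_unit v" "a = v * y" by (auto simp: strongly_associate_def)
    then show "strongly_associate b y"
      using strongly_associate_unit_multiples[of u v b y] u by simp
  qed
  then show ?thesis by (cases \<beta>) (simp_all add: associate_def pr)
qed

text \<open>If \<open>a = b * r\<close> and \<open>b = a * s\<close>, then cancelling the regular \<open>a\<close> in \<open>a * (s * r) = a\<close> shows that \<open>r\<close>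
  is a unit.\<close>

lemma associate_imp_strongly_associate:
  assumes "a \<in> Reg" "associate a b"
  shows "strongly_associate a b"
proof -
  from assms(2) have "a dvd b" "b dvd a"
    by (auto simp: associate_def principal_eq_iff_dvd)
  then obtain r s where rs: "a = b * r" "b = a * s" by (auto simp: dvd_def)
  have "a * (s * r) = (a * s) * r" by (simp add: mult.assoc)
  also have "\<dots> = b * r" by (simp only: rs(2))
  also have "\<dots> = a * 1" by (simp only: rs(1) mult_1_right)
  finally have "a * (s * r) = a * 1" .
  then have "s * r = 1" using Reg_cancel assms(1) by blast
  then have "ring_unit r" using dvd_triv_right[of r s] by simp
  moreover have "a = r * b" using rs(1) by (simp only: mult.commute)
  ultimately show ?thesis unfolding strongly_associate_def by blast
qed

lemma assoc_by_iff_associate: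
  assumes "a \<in> Reg"
  shows "assoc_by \<beta> a b \<longleftrightarrow> associate a b"
proof (cases \<beta>)
  case Strongly_Associate
  then show ?thesis
    using associate_imp_strongly_associate[OF assms, of b]
      strongly_associate_imp_assoc_by[of a b Associate] by (metis assoc_by.simps)
qed simp

section \<open>Factorizations with respect to the regular part of a relation\<close>

lemma factorization_singleton:
  "factorization \<sigma> a u [b] \<longleftrightarrow> \<not> ring_unit a \<and> \<not> ring_unit b \<and> ring_unit u \<and> a = u * b"
  by (auto simp: factorization_def)

lemma factorization_self: "\<not> ring_unit a \<Longrightarrow> factorization \<sigma> a 1 [a]"
  by (simp add: factorization_singleton)

lemma factorization_factor_dvd:
  assumes "factorization \<sigma> a u as" "x \<in> set as"
  shows "x dvd a"
proof -
  have "x dvd prod_list as" using assms(2) by (rule prod_list_dvd)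
  then show ?thesis using assms(1) by (simp add: factorization_def)
qed

lemma factorization_factor_Reg:
  "factorization \<sigma> a u as \<Longrightarrow> a \<in> Reg \<Longrightarrow> x \<in> set as \<Longrightarrow> x \<in> Reg"
  using factorization_factor_dvd Reg_dvd by blast

lemma divisor_Reg: "divisor \<sigma> b a \<Longrightarrow> a \<in> Reg \<Longrightarrow> b \<in> Reg"
  unfolding divisor_def using factorization_factor_Reg by blast

lemma factorization_factor_nonunit:
  "factorization \<sigma> a u as \<Longrightarrow> x \<in> set as \<Longrightarrow> \<not> ring_unit x"
  by (simp add: factorization_def)

lemma factorization_nonunit: "factorization \<sigma> a u as \<Longrightarrow> \<not> ring_unit a"
  unfolding factorization_def by blast

lemma factorization_reg_restrict:
  assumes "a \<in> Reg"
  shows "factorization (reg_restrict \<tau>) a u as \<longleftrightarrow> factorization \<tau> a u as"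
proof
  assume "factorization (reg_restrict \<tau>) a u as"
  then show "factorization \<tau> a u as" by (auto simp: factorization_def reg_restrict_def)
next
  assume f: "factorization \<tau> a u as"
  then have "as ! i \<in> Reg" if "i < length as" for i
    using factorization_factor_Reg assms that nth_mem by blast
  moreover have "\<forall>i<length as. \<forall>j<length as. i \<noteq> j \<longrightarrow> (as ! i, as ! j) \<in> \<tau>"
    using f unfolding factorization_def by (elim conjE)
  ultimately have "\<forall>i<length as. \<forall>j<length as. i \<noteq> j \<longrightarrow> (as ! i, as ! j) \<in> reg_restrict \<tau>"
    by (simp add: reg_restrict_def)
  with f show "factorization (reg_restrict \<tau>) a u as"
    unfolding factorization_def by (elim conjE) (intro conjI; assumption)
qed

lemma divisor_reg_restrict: "a \<in> Reg \<Longrightarrow> divisor (reg_restrict \<tau>) b a \<longleftrightarrow> divisor \<tau> b a"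
  by (simp add: divisor_def factorization_reg_restrict)

text \<open>In a factorization with at least two factors, each factor is paired with another one, so that the
  relation forces it to be regular; but then the product is regular, too.\<close>

lemma nonregular_factorization_trivial:
  assumes f: "factorization (reg_restrict \<tau>) a u as" and a: "a \<notin> Reg"
  obtains b where "as = [b]" "strongly_associate a b" "b \<notin> Reg"
proof -
  have u: "ring_unit u" and prod: "a = u * prod_list as" and "as \<noteq> []"
    using f by (auto simp: factorization_def)
  have uR: "u \<in> Reg" using Reg_dvd[OF Reg_one u] .
  have "length as = 1"
  proof (rule ccontr)
    assume "length as \<noteq> 1"
    then have len: "length as > 1" using \<open>as \<noteq> []\<close> by (cases as) auto
    have "as ! i \<in> Reg" if "i < length as" for i
    proof -
      obtain j where "j < length as" "i \<noteq> j"
        using len by (metis less_trans zero_less_one zero_neq_one)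
      then show ?thesis
        using f that by (auto simp: factorization_def reg_restrict_def)
    qed
    then have "set as \<subseteq> Reg" by (auto simp: set_conv_nth)
    then have "a \<in> Reg" using Reg_prod_list Reg_mult uR prod by blast
    with a show False ..
  qed
  then obtain b where b: "as = [b]" by (auto simp: length_Suc_conv)
  then have ab: "a = u * b" using prod by simp
  have "b \<notin> Reg" using ab a Reg_mult[OF uR] by blast
  then show ?thesis using that b ab u by (auto simp: strongly_associate_def)
qed

lemma nonregular_factorization_length:
  "factorization (reg_restrict \<tau>) a u as \<Longrightarrow> a \<notin> Reg \<Longrightarrow> length as = 1"
  by (erule (1) nonregular_factorization_trivial) simp

text \<open>Cancelling the factor that is an associate of the product leaves a product of the other factors
  that is a unit, so there are no other factors.\<close>

lemma factor_associate_imp_trivial: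
  assumes f: "factorization \<sigma> a u as" and a: "a \<in> Reg"
    and x: "x \<in> set as" "associate a x"
  shows "as = [x]"
proof -
  obtain ys zs where as: "as = ys @ x # zs" using x(1) by (meson split_list)
  have "a dvd x" using x(2) by (simp add: associate_def principal_eq_iff_dvd)
  then obtain r where r: "x = a * r" ..
  have "a = u * prod_list as" using f by (simp add: factorization_def)
  also have "\<dots> = a * ((r * u) * prod_list (ys @ zs))" by (simp add: as r mult_ac)
  finally have "a * ((r * u) * prod_list (ys @ zs)) = a * 1" by simp
  then have "(r * u) * prod_list (ys @ zs) = 1" using Reg_cancel[OF a] by blast
  then have unit: "ring_unit (prod_list (ys @ zs))"
    using dvd_triv_right[of "prod_list (ys @ zs)" "r * u"] by simp
  have "ys @ zs = []"
  proof (rule ccontr)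
    assume "ys @ zs \<noteq> []"
    then obtain y where y: "y \<in> set (ys @ zs)" using list.set_sel(1) by blast
    then have "y dvd prod_list (ys @ zs)" by (rule prod_list_dvd)
    then have "ring_unit y" using unit by (rule dvd_trans)
    moreover have "y \<in> set as" using y as by auto
    ultimately show False using factorization_factor_nonunit[OF f] by blast
  qed
  then show ?thesis using as by simp
qed

section \<open>Atoms\<close>

text \<open>For a factorization of a regular element, each of the defining conditions of the four kinds of
  atoms says that it is trivial.\<close>

lemma is_atom_iff_regular_irreducible:
  assumes a: "a \<in> Reg"
  shows "is_atom \<alpha> (reg_restrict \<tau>) a \<longleftrightarrow> regular_irreducible \<tau> a"
proof -
  have tr: "length as = 1 \<longleftrightarrow> (\<exists>x\<in>set as. associate a x)"
    "length as = 1 \<longleftrightarrow> (\<exists>x\<in>set as. strongly_associate a x)"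
    "length as = 1 \<longleftrightarrow> (\<forall>x\<in>set as. associate a x)"
    if f: "factorization \<tau> a u as" for u as
  proof -
    have 1: "length as = 1" if "\<exists>x\<in>set as. associate a x"
      using factor_associate_imp_trivial[OF f a] that by fastforce
    have 2: "\<forall>x\<in>set as. associate a x" if "length as = 1"
      using f that
      by (auto simp: length_Suc_conv factorization_singleton associate_def principal_unit_mult)
    have 3: "\<exists>x. x \<in> set as" using f by (auto simp: factorization_def intro: list.set_sel(1))
    have 4: "strongly_associate a x \<longleftrightarrow> associate a x" for x
      using assoc_by_iff_associate[OF a, of Strongly_Associate] by simp
    show "length as = 1 \<longleftrightarrow> (\<exists>x\<in>set as. associate a x)" using 1 2 3 by blast
    then show "length as = 1 \<longleftrightarrow> (\<exists>x\<in>set as. strongly_associate a x)" by (simp only: 4)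
    show "length as = 1 \<longleftrightarrow> (\<forall>x\<in>set as. associate a x)" using 1 2 3 by blast
  qed
  have irr: "regular_irreducible \<tau> a \<longleftrightarrow>
      \<not> ring_unit a \<and> (\<forall>u as. factorization \<tau> a u as \<longrightarrow> length as = 1)"
    unfolding regular_irreducible_def Reg_nonunits_def regular_factorization_def
    using a tr(1) by blast
  show ?thesis
  proof (cases \<alpha>)
    case Atomic
    show ?thesis
      unfolding irr Atomic is_atom.simps factorization_reg_restrict[OF a] using tr(1) by blast
  next
    case Strongly_Atomic
    show ?thesis
      unfolding irr Strongly_Atomic is_atom.simps factorization_reg_restrict[OF a]
      using tr(2) by blast
  next
    case M_Atomic
    show ?thesis
      unfolding irr M_Atomic is_atom.simps factorization_reg_restrict[OF a] using tr(3) by blast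
  next
    case Unrefinably_Atomic
    show ?thesis
      unfolding irr Unrefinably_Atomic is_atom.simps factorization_reg_restrict[OF a] ..
  qed
qed

lemma nonregular_is_atom:
  assumes a: "a \<notin> Reg" and "\<not> ring_unit a"
  shows "is_atom \<alpha> (reg_restrict \<tau>) a"
proof -
  have tr: "\<exists>b. as = [b] \<and> strongly_associate a b \<and> associate a b"
    if "factorization (reg_restrict \<tau>) a u as" for u as
    using nonregular_factorization_trivial[OF that a] strongly_associate_imp_assoc_by[of a _ Associate]
    by (metis assoc_by.simps(1))
  show ?thesis
    using assms(2) by (cases \<alpha>) (auto dest: tr)
qed

lemma atom_factorization_iff_regular:
  assumes a: "a \<in> Reg"
  shows "atom_factorization \<alpha> (reg_restrict \<tau>) a u as \<longleftrightarrow> regular_atomic_factorization \<tau> a u as"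
proof -
  have "is_atom \<alpha> (reg_restrict \<tau>) x \<longleftrightarrow> regular_irreducible \<tau> x"
    if "factorization \<tau> a u as" "x \<in> set as" for x
    using factorization_factor_Reg[OF that(1) a that(2)] by (rule is_atom_iff_regular_irreducible)
  then show ?thesis
    unfolding atom_factorization_def regular_atomic_factorization_def regular_factorization_def
      factorization_reg_restrict[OF a]
    using a by blast
qed

lemma regular_atomic_factorization_Reg: "regular_atomic_factorization \<tau> a u as \<Longrightarrow> a \<in> Reg"
  by (simp add: regular_atomic_factorization_def regular_factorization_def)

text \<open>The uniqueness clauses of the half-factorial and unique factorization properties have a common
  shape, with \<open>P\<close> comparing two factorizations. Two factorizations of a non-regular element
  both consist of a strong associate of it, which accounts for the hypothesis on \<open>P\<close>.\<close>

lemma all_atom_factorization_pairs_iff_regular: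
  assumes "\<And>u v b c. strongly_associate b c \<Longrightarrow> P u [b] v [c]"
  shows "(\<forall>a u as v bs. atom_factorization \<alpha> (reg_restrict \<tau>) a u as \<and>
            atom_factorization \<alpha> (reg_restrict \<tau>) a v bs \<longrightarrow> P u as v bs) \<longleftrightarrow>
         (\<forall>a u as v bs. regular_atomic_factorization \<tau> a u as \<and>
            regular_atomic_factorization \<tau> a v bs \<longrightarrow> P u as v bs)"
    (is "?L \<longleftrightarrow> ?R")
proof
  assume ?L
  then show ?R
    by (metis atom_factorization_iff_regular regular_atomic_factorization_Reg)
next
  assume R: ?R
  show ?L
  proof (intro allI impI, elim conjE)
    fix a u as v bs
    assume f: "atom_factorization \<alpha> (reg_restrict \<tau>) a u as"
      "atom_factorization \<alpha> (reg_restrict \<tau>) a v bs"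
    show "P u as v bs"
    proof (cases "a \<in> Reg")
      case True
      then show ?thesis using R f by (metis atom_factorization_iff_regular)
    next
      case False
      have f': "factorization (reg_restrict \<tau>) a u as" "factorization (reg_restrict \<tau>) a v bs"
        using f by (auto simp: atom_factorization_def)
      obtain b c where bc: "as = [b]" "bs = [c]"
        using nonregular_factorization_trivial[OF _ False] f' by metis
      then have "strongly_associate b c"
        using f' strongly_associate_unit_multiples[of u v b c]
        by (auto simp: factorization_singleton)
      then show ?thesis using assms bc by simp
    qed
  qed
qed

section \<open>Atomic rings, half-factorial and unique factorization rings\<close>

lemma regular_atomic_iff_atomic_ring: "regular_atomic \<tau> \<longleftrightarrow> atomic_ring \<alpha> (reg_restrict \<tau>)"
proof
  assume r: "regular_atomic \<tau>"
  show "atomic_ring \<alpha> (reg_restrict \<tau>)"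
    unfolding atomic_ring_def
  proof (intro allI impI)
    fix a :: 'a assume a: "\<not> ring_unit a"
    show "\<exists>u as. atom_factorization \<alpha> (reg_restrict \<tau>) a u as"
    proof (cases "a \<in> Reg")
      case True
      then show ?thesis
        using r a by (auto simp: regular_atomic_def Reg_nonunits_def atom_factorization_iff_regular)
    next
      case False
      then have "atom_factorization \<alpha> (reg_restrict \<tau>) a 1 [a]"
        using a by (simp add: atom_factorization_def factorization_self nonregular_is_atom)
      then show ?thesis by blast
    qed
  qed
next
  assume at: "atomic_ring \<alpha> (reg_restrict \<tau>)"
  show "regular_atomic \<tau>"
    unfolding regular_atomic_def
  proof
    fix a :: 'a assume "a \<in> Reg_nonunits"
    then have a: "a \<in> Reg" "\<not> ring_unit a" by (simp_all add: Reg_nonunits_def)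
    then have "\<exists>u as. atom_factorization \<alpha> (reg_restrict \<tau>) a u as"
      using at unfolding atomic_ring_def by blast
    then show "\<exists>u as. regular_atomic_factorization \<tau> a u as"
      unfolding atom_factorization_iff_regular[OF a(1)] .
  qed
qed

lemma regular_HFR_iff_HFR: "regular_HFR \<tau> \<longleftrightarrow> HFR \<alpha> (reg_restrict \<tau>)"
  unfolding regular_HFR_def HFR_def regular_atomic_iff_atomic_ring[of \<tau> \<alpha>]
  by (subst all_atom_factorization_pairs_iff_regular[where P = "\<lambda>_ as _ bs. length as = length bs"])
    simp_all

lemma rearranged_by_cong_Reg:
  assumes "set as \<subseteq> Reg"
  shows "rearranged_by (assoc_by \<beta>) (u, as) q \<longleftrightarrow> rearranged_by associate (u, as) q"
proof -
  have "as ! i \<in> Reg" if "i < length as" for i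
    using assms that nth_mem by blast
  then have "list_all2 (assoc_by \<beta>) as cs \<longleftrightarrow> list_all2 associate as cs" for cs
    by (auto simp: list_all2_conv_all_nth assoc_by_iff_associate)
  then show ?thesis by (simp add: rearranged_by_def)
qed

lemma regular_UFR_iff_UFR: "regular_UFR \<tau> \<longleftrightarrow> UFR \<alpha> \<beta> (reg_restrict \<tau>)"
proof -
  have 1: "rearranged_by (assoc_by \<beta>) (u, [b]) (v, [c])" if "strongly_associate b c" for u v b c :: 'a
    unfolding rearranged_by_def
    by (rule exI[of _ "[c]"]) (simp add: strongly_associate_imp_assoc_by that)
  have "rearranged_by (assoc_by \<beta>) (u, as) q \<longleftrightarrow> rearranged_by associate (u, as) q"
    if "regular_atomic_factorization \<tau> a u as" for a u as q
    using that factorization_factor_Reg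
    by (intro rearranged_by_cong_Reg)
      (auto simp: regular_atomic_factorization_def regular_factorization_def)
  then have "(\<forall>a u as v bs. regular_atomic_factorization \<tau> a u as \<and>
            regular_atomic_factorization \<tau> a v bs \<longrightarrow> rearranged_by associate (u, as) (v, bs)) \<longleftrightarrow>
        (\<forall>a u as v bs. regular_atomic_factorization \<tau> a u as \<and>
            regular_atomic_factorization \<tau> a v bs \<longrightarrow>
            rearranged_by (assoc_by \<beta>) (u, as) (v, bs))"
    by blast
  then show ?thesis
    unfolding regular_UFR_def UFR_def regular_HFR_iff_HFR[of \<tau> \<alpha>]
    by (subst all_atom_factorization_pairs_iff_regular
        [where P = "\<lambda>u as v bs. rearranged_by (assoc_by \<beta>) (u, as) (v, bs)"])
      (simp_all add: 1)
qed

section \<open>Bounded factorization and chain conditions\<close>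

lemma regular_BFR_iff_BFR: "regular_BFR \<tau> \<longleftrightarrow> BFR (reg_restrict \<tau>)"
proof
  assume r: "regular_BFR \<tau>"
  show "BFR (reg_restrict \<tau>)"
    unfolding BFR_def
  proof (intro allI impI)
    fix a :: 'a assume a: "\<not> ring_unit a"
    show "\<exists>N. \<forall>u as. factorization (reg_restrict \<tau>) a u as \<longrightarrow> length as \<le> N"
    proof (cases "a \<in> Reg")
      case True
      then show ?thesis
        using r by (auto simp: regular_BFR_def regular_factorization_def factorization_reg_restrict)
    next
      case False
      then have "\<forall>u as. factorization (reg_restrict \<tau>) a u as \<longrightarrow> length as \<le> 1"
        using nonregular_factorization_length by fastforce
      then show ?thesis by blast
    qed
  qed
next
  assume B: "BFR (reg_restrict \<tau>)"
  show "regular_BFR \<tau>"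
    unfolding regular_BFR_def regular_factorization_def
  proof
    fix a :: 'a assume a: "a \<in> Reg"
    show "\<exists>N. \<forall>u as. a \<in> Reg \<and> factorization \<tau> a u as \<longrightarrow> length as \<le> N"
    proof (cases "ring_unit a")
      case True
      then show ?thesis by (auto simp: factorization_def)
    next
      case False
      then have "\<exists>N. \<forall>u as. factorization (reg_restrict \<tau>) a u as \<longrightarrow> length as \<le> N"
        using B unfolding BFR_def by blast
      then show ?thesis unfolding factorization_reg_restrict[OF a] by blast
    qed
  qed
qed

text \<open>A unit multiple is absorbed into the leading unit of a factorization.\<close>

lemma divisor_unit_multiple:
  assumes d: "divisor \<sigma> b a" and s: "strongly_associate c a"
  shows "divisor \<sigma> b c"
proof -
  obtain u as where f: "factorization \<sigma> a u as" "b \<in> set as"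
    using d by (auto simp: divisor_def)
  obtain v where v: "ring_unit v" "c = v * a" using s by (auto simp: strongly_associate_def)
  have "\<not> ring_unit c"
    using v(2) factorization_nonunit[OF f(1)] dvd_trans[of a c 1] by auto
  then have "factorization \<sigma> c (v * u) as"
    using f(1) v by (auto simp: factorization_def ring_unit_mult mult.assoc)
  then show ?thesis using f(2) by (auto simp: divisor_def)
qed

text \<open>From a non-regular member on, a chain for the restricted relation is constant, since all further
  members are strong associates. Given a chain that never becomes constant, each of its members has a later one that is
  strictly larger. The first such member is a divisor of its predecessor, which still generates
  the old ideal, and hence is a divisor of the given member. Iterating this step gives
  a strictly ascending chain.\<close>

lemma regular_ACCP_imp_ACCP:
  assumes r: "regular_ACCP \<tau>"
  shows "ACCP (reg_restrict \<tau>)"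
  unfolding ACCP_def
proof (intro allI impI)
  fix f :: "nat \<Rightarrow> 'a"
  assume "\<forall>i. principal (f i) \<subseteq> principal (f (Suc i)) \<and> divisor (reg_restrict \<tau>) (f (Suc i)) (f i)"
  then have sub: "principal (f i) \<subseteq> principal (f (Suc i))"
    and div: "divisor (reg_restrict \<tau>) (f (Suc i)) (f i)" for i by auto
  show "\<exists>N. \<forall>n\<ge>N. principal (f n) = principal (f N)"
  proof (rule ccontr)
    assume "\<not> ?thesis"
    then have nc: "\<exists>n\<ge>N. principal (f n) \<noteq> principal (f N)" for N by blast
    have reg: "f i \<in> Reg" for i
    proof (rule ccontr)
      assume i: "f i \<notin> Reg"
      have const: "f n \<notin> Reg \<and> principal (f n) = principal (f i)" if "n \<ge> i" for n
        using that
      proof (induction n rule: dec_induct)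
        case base
        then show ?case using i by simp
      next
        case (step n)
        obtain u as where fa: "factorization (reg_restrict \<tau>) (f n) u as" "f (Suc n) \<in> set as"
          using div[of n] by (auto simp: divisor_def)
        then have "f (Suc n) \<notin> Reg" "strongly_associate (f n) (f (Suc n))"
          using nonregular_factorization_trivial[OF fa(1)] step.IH by force+
        moreover from this have "principal (f n) = principal (f (Suc n))"
          using strongly_associate_imp_assoc_by[of "f n" "f (Suc n)" Associate]
          by (simp add: associate_def)
        ultimately show ?case using step.IH by simp
      qed
      obtain n where n: "n \<ge> i" "principal (f n) \<noteq> principal (f i)" using nc[of i] by (elim exE conjE)
      show False using const[OF n(1)] n(2) by simp
    qed
    have step: "\<exists>m. principal (f n) \<subset> principal (f m) \<and> divisor \<tau> (f m) (f n)" for n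
    proof -
      define Q where "Q m \<longleftrightarrow> n \<le> m \<and> principal (f m) \<noteq> principal (f n)" for m
      have "\<exists>m. Q m" using nc[of n] by (simp add: Q_def)
      then have "Q (LEAST m. Q m)" by (rule LeastI_ex)
      then obtain m where m: "m = (LEAST m. Q m)" "n \<le> m" "principal (f m) \<noteq> principal (f n)"
        by (simp add: Q_def)
      have "m \<noteq> n" using m(3) by auto
      with m(2) obtain p where p: "m = Suc p" "n \<le> p" by (cases m) auto
      have "\<not> Q p" using m(1) p(1) by (intro not_less_Least) simp
      then have "principal (f p) = principal (f n)" using p(2) by (simp add: Q_def)
      moreover from this have "strongly_associate (f n) (f p)"
        using associate_imp_strongly_associate[OF reg] by (simp add: associate_def)
      moreover have "divisor \<tau> (f m) (f p)"
        using div[of p] divisor_reg_restrict[OF reg] p(1) by simp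
      ultimately have "divisor \<tau> (f m) (f n)" "principal (f n) \<subset> principal (f m)"
        using m sub[of p] p(1) divisor_unit_multiple by (simp_all add: psubset_eq)
      then show ?thesis by blast
    qed
    then obtain nx where nx: "principal (f n) \<subset> principal (f (nx n)) \<and> divisor \<tau> (f (nx n)) (f n)"
      for n by metis
    define g where "g k = f ((nx ^^ k) 0)" for k
    have "g k \<in> Reg \<and> principal (g k) \<subset> principal (g (Suc k)) \<and>
        (\<exists>u as. regular_factorization \<tau> (g k) u as \<and> g (Suc k) \<in> set as)" for k
      using nx[of "(nx ^^ k) 0"] reg by (auto simp: g_def divisor_def regular_factorization_def)
    then have "\<exists>g :: nat \<Rightarrow> 'a. \<forall>k. g k \<in> Reg \<and> principal (g k) \<subset> principal (g (Suc k)) \<and>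
        (\<exists>u as. regular_factorization \<tau> (g k) u as \<and> g (Suc k) \<in> set as)"
      by (intro exI[of _ g]) simp
    then show False using r unfolding regular_ACCP_def by (rule notE[rotated])
  qed
qed

lemma regular_ACCP_iff_ACCP: "regular_ACCP \<tau> \<longleftrightarrow> ACCP (reg_restrict \<tau>)"
proof
  assume A: "ACCP (reg_restrict \<tau>)"
  show "regular_ACCP \<tau>"
    unfolding regular_ACCP_def
  proof
    assume "\<exists>f. \<forall>i. f i \<in> Reg \<and> principal (f i) \<subset> principal (f (Suc i)) \<and>
        (\<exists>u as. regular_factorization \<tau> (f i) u as \<and> f (Suc i) \<in> set as)"
    then obtain f where f: "\<forall>i. f i \<in> Reg \<and> principal (f i) \<subset> principal (f (Suc i)) \<and>
        (\<exists>u as. regular_factorization \<tau> (f i) u as \<and> f (Suc i) \<in> set as)" ..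
    have "divisor (reg_restrict \<tau>) (f (Suc i)) (f i)" for i
    proof -
      obtain u as where "regular_factorization \<tau> (f i) u as" "f (Suc i) \<in> set as"
        using spec[OF f, of i] by (elim conjE exE)
      then have "divisor \<tau> (f (Suc i)) (f i)" "f i \<in> Reg"
        by (auto simp: divisor_def regular_factorization_def)
      then show ?thesis by (simp only: divisor_reg_restrict)
    qed
    moreover have "principal (f i) \<subseteq> principal (f (Suc i))" for i
      using spec[OF f, of i] by (elim conjE) (rule less_imp_le)
    ultimately have chain: "\<forall>i. principal (f i) \<subseteq> principal (f (Suc i)) \<and>
        divisor (reg_restrict \<tau>) (f (Suc i)) (f i)"
      by simp
    have "(\<forall>i. principal (f i) \<subseteq> principal (f (Suc i)) \<and>
        divisor (reg_restrict \<tau>) (f (Suc i)) (f i)) \<longrightarrow>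
        (\<exists>N. \<forall>n\<ge>N. principal (f n) = principal (f N))"
      using A unfolding ACCP_def by (rule spec)
    then have "\<exists>N. \<forall>n\<ge>N. principal (f n) = principal (f N)" using chain by (rule mp)
    then obtain N where "\<forall>n\<ge>N. principal (f n) = principal (f N)" ..
    then have "N \<le> Suc N \<longrightarrow> principal (f (Suc N)) = principal (f N)" by (rule spec)
    then show False using spec[OF f, of N] by simp
  qed
qed (rule regular_ACCP_imp_ACCP)

section \<open>Finiteness up to associates\<close>

lemma all_nonunits_iff_all_regular:
  assumes "\<And>a. a \<in> Reg \<Longrightarrow> P a \<longleftrightarrow> Q a" "\<And>a. a \<notin> Reg \<Longrightarrow> P a"
  shows "(\<forall>a\<in>Reg_nonunits. Q a) \<longleftrightarrow> (\<forall>a. \<not> ring_unit a \<longrightarrow> P a)"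
proof -
  have "(\<forall>a\<in>Reg_nonunits. Q a) \<longleftrightarrow> (\<forall>a. \<not> ring_unit a \<longrightarrow> a \<in> Reg \<longrightarrow> P a)"
    using assms(1) by (auto simp: Reg_nonunits_def)
  then show ?thesis using assms(2) by metis
qed

text \<open>If \<open>f\<close> is a complete invariant for the equivalence \<open>E\<close>, classes can be counted as values of
  \<open>f\<close>. For associates, the invariant is the principal ideal.\<close>

lemma finite_up_to_kernel:
  assumes "\<And>x y. E x y \<longleftrightarrow> f x = f y"
  shows "finite_up_to E A \<longleftrightarrow> finite (f ` A)"
proof -
  have "A // {(x, y). E x y} = (\<lambda>c. {y. c = f y}) ` (f ` A)"
    by (auto simp: quotient_def assms)
  moreover have "inj_on (\<lambda>c. {y. c = f y}) (f ` A)"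
    by (auto simp: inj_on_def)
  ultimately show ?thesis by (simp add: finite_up_to_def finite_image_iff)
qed

lemma finite_up_to_cong:
  assumes "\<And>x y. x \<in> A \<Longrightarrow> E x y \<longleftrightarrow> E' x y"
  shows "finite_up_to E A \<longleftrightarrow> finite_up_to E' A"
proof -
  have "A // {(x, y). E x y} = A // {(x, y). E' x y}"
    using assms by (auto simp: quotient_def)
  then show ?thesis by (simp add: finite_up_to_def)
qed

lemma finite_up_to_associate: "finite_up_to associate A \<longleftrightarrow> finite (principal ` A)"
  by (rule finite_up_to_kernel) (simp add: associate_def)

lemma finite_up_to_assoc_by_Reg:
  assumes "A \<subseteq> Reg"
  shows "finite_up_to (assoc_by \<beta>) A \<longleftrightarrow> finite (principal ` A)"
  using assms assoc_by_iff_associate finite_up_to_cong[of A "assoc_by \<beta>" associate]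
  by (auto simp: finite_up_to_associate)

lemma regular_idf_iff_df_ring: "regular_idf \<tau> \<longleftrightarrow> df_ring \<alpha> \<beta> (reg_restrict \<tau>)"
proof -
  have reg: "finite_up_to (assoc_by \<beta>) {b. divisor (reg_restrict \<tau>) b a \<and> is_atom \<alpha> (reg_restrict \<tau>) b}
      \<longleftrightarrow> finite_up_to associate {b. divisor \<tau> b a \<and> regular_irreducible \<tau> b}"
    if a: "a \<in> Reg" for a
  proof -
    have "{b. divisor (reg_restrict \<tau>) b a \<and> is_atom \<alpha> (reg_restrict \<tau>) b} =
        {b. divisor \<tau> b a \<and> regular_irreducible \<tau> b}"
      using a divisor_Reg[OF _ a] by (auto simp: divisor_reg_restrict is_atom_iff_regular_irreducible)
    moreover have "{b. divisor \<tau> b a \<and> regular_irreducible \<tau> b} \<subseteq> Reg"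
      using divisor_Reg[OF _ a] by blast
    ultimately show ?thesis by (simp add: finite_up_to_assoc_by_Reg finite_up_to_associate)
  qed
  have nonreg: "finite_up_to (assoc_by \<beta>) {b. divisor (reg_restrict \<tau>) b a \<and> is_atom \<alpha> (reg_restrict \<tau>) b}"
    (is "finite_up_to _ ?A") if a: "a \<notin> Reg" for a
  proof -
    \<comment> \<open>The argument via principal ideals is not available here: for a non-regular \<open>a\<close>, being
      strongly associate is in general finer than generating the same ideal. But there is only one
      class.\<close>
    have sa: "strongly_associate a b" if "b \<in> ?A" for b
      using that nonregular_factorization_trivial[OF _ a] by (force simp: divisor_def)
    have "?A // {(x, y). assoc_by \<beta> x y} \<subseteq> {{y. assoc_by \<beta> a y}}"
      using assoc_by_class_cong[OF sa] by (auto simp: quotient_def)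
    then show ?thesis unfolding finite_up_to_def by (rule finite_subset) simp
  qed
  show ?thesis
    unfolding regular_idf_def df_ring_def
    by (rule all_nonunits_iff_all_regular[OF reg nonreg])
qed

text \<open>The \<open>\<tau>\<close>-regular condition counts the trivial divisors of \<open>a\<close> as well, but these add only the
  class of \<open>a\<close>. A non-regular element has no non-trivial divisors for the restricted relation.\<close>

lemma regular_WFFR_iff_WFFR: "regular_WFFR \<tau> \<longleftrightarrow> WFFR \<beta> (reg_restrict \<tau>)"
proof -
  have reg: "finite_up_to (assoc_by \<beta>) {b. nontrivial_divisor (reg_restrict \<tau>) b a}
      \<longleftrightarrow> finite_up_to associate {b. divisor \<tau> b a}" (is "finite_up_to _ ?N \<longleftrightarrow> finite_up_to _ ?D")
    if a: "a \<in> Reg" for a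
  proof -
    have N: "nontrivial_divisor (reg_restrict \<tau>) b a \<longleftrightarrow> nontrivial_divisor \<tau> b a" for b
      by (simp add: nontrivial_divisor_def factorization_reg_restrict a)
    have ND: "?N \<subseteq> ?D" unfolding N by (auto simp: nontrivial_divisor_def divisor_def)
    have "principal b = principal a" if b: "b \<in> ?D" "b \<notin> ?N" for b
    proof -
      obtain u as where f: "factorization \<tau> a u as" "b \<in> set as"
        using b(1) by (auto simp: divisor_def)
      then have "length as = 1" using b(2) unfolding N by (auto simp: nontrivial_divisor_def)
      then have "as = [b]" using f(2) by (auto simp: length_Suc_conv)
      then show ?thesis using f(1) by (simp add: factorization_singleton principal_unit_mult)
    qed
    then have DN: "principal ` ?D \<subseteq> insert (principal a) (principal ` ?N)" by blast
    have "?N \<subseteq> Reg" using ND divisor_Reg[OF _ a] by blast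
    then show ?thesis
      using ND DN by (metis finite_insert finite_subset finite_up_to_assoc_by_Reg
          finite_up_to_associate image_mono)
  qed
  have "\<not> nontrivial_divisor (reg_restrict \<tau>) b a" if a: "a \<notin> Reg" for a b
    unfolding nontrivial_divisor_def
    using nonregular_factorization_length[OF _ a] by simp
  then have nonreg: "finite_up_to (assoc_by \<beta>) {b. nontrivial_divisor (reg_restrict \<tau>) b a}"
    if "a \<notin> Reg" for a using that by (simp add: finite_up_to_def)
  show ?thesis
    unfolding regular_WFFR_def WFFR_def
    by (rule all_nonunits_iff_all_regular[OF reg nonreg])
qed

text \<open>Two lists agree up to rearrangement and associates exactly if the multisets of the principal
  ideals of their entries are equal; this multiset is the class multiset of a list.\<close>

definition class_multiset :: "'a::comm_ring_1 list \<Rightarrow> 'a set multiset" where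
  "class_multiset as = image_mset principal (mset as)"

lemma rearranged_by_associate_iff:
  "rearranged_by associate p q \<longleftrightarrow> class_multiset (snd p) = class_multiset (snd q)"
proof
  assume "rearranged_by associate p q"
  then obtain cs where cs: "mset cs = mset (snd q)" "list_all2 associate (snd p) cs"
    by (auto simp: rearranged_by_def)
  from cs(2) have "map principal (snd p) = map principal cs"
    by (auto simp: associate_def list_all2_conv_all_nth intro: nth_equalityI)
  then show "class_multiset (snd p) = class_multiset (snd q)"
    using cs(1) by (metis class_multiset_def mset_map)
next
  assume "class_multiset (snd p) = class_multiset (snd q)"
  then have "mset (map principal (snd p)) = mset (map principal (snd q))"
    by (simp add: class_multiset_def)
  moreover have "list_all2 (\<lambda>X b. X = principal b) (map principal (snd q)) (snd q)"
    by (simp add: list_all2_conv_all_nth)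
  ultimately obtain cs where
    cs: "list_all2 (\<lambda>X b. X = principal b) (map principal (snd p)) cs" "mset cs = mset (snd q)"
    using list_all2_reorder_left_invariance by blast
  from cs(1) have "list_all2 associate (snd p) cs"
    by (simp add: list_all2_conv_all_nth associate_def)
  then show "rearranged_by associate p q" using cs(2) by (auto simp: rearranged_by_def)
qed

lemma finite_up_to_rearranged_associate:
  "finite_up_to (rearranged_by associate) A \<longleftrightarrow> finite ((\<lambda>p. class_multiset (snd p)) ` A)"
  by (rule finite_up_to_kernel) (rule rearranged_by_associate_iff)

text \<open>Again the trivial factorizations, which only the \<open>\<tau>\<close>-regular condition counts, form one class.\<close>

lemma regular_FFR_iff_FFR: "regular_FFR \<tau> \<longleftrightarrow> FFR \<beta> (reg_restrict \<tau>)"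
proof -
  have reg: "finite_up_to (rearranged_by (assoc_by \<beta>))
        {(u, as). factorization (reg_restrict \<tau>) a u as \<and> length as \<noteq> 1}
      \<longleftrightarrow> finite_up_to (rearranged_by associate) {(u, as). factorization \<tau> a u as}"
    (is "finite_up_to _ ?N \<longleftrightarrow> finite_up_to _ ?D") if a: "a \<in> Reg" for a
  proof -
    let ?c = "\<lambda>p. class_multiset (snd p)"
    have ND: "?N \<subseteq> ?D" by (auto simp: factorization_reg_restrict a)
    have "?c p = {#principal a#}" if "p \<in> ?D" "p \<notin> ?N" for p
    proof -
      obtain u as where p: "p = (u, as)" by (cases p)
      then have f: "factorization \<tau> a u as" and "length as = 1"
        using that by (simp_all add: factorization_reg_restrict a)
      then obtain b where "as = [b]" by (auto simp: length_Suc_conv)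
      then have "p = (u, [b])" "factorization \<tau> a u [b]" using p f by simp_all
      then show ?thesis by (simp add: factorization_singleton principal_unit_mult class_multiset_def)
    qed
    then have DN: "?c ` ?D \<subseteq> insert {#principal a#} (?c ` ?N)" by blast
    have "finite_up_to (rearranged_by (assoc_by \<beta>)) ?N \<longleftrightarrow> finite_up_to (rearranged_by associate) ?N"
      using factorization_factor_Reg[OF _ a]
      by (intro finite_up_to_cong) (auto intro!: rearranged_by_cong_Reg)
    then show ?thesis
      unfolding finite_up_to_rearranged_associate
      using ND DN by (metis (no_types, lifting) finite_insert finite_subset image_mono)
  qed
  have empty: "{(u, as). factorization (reg_restrict \<tau>) a u as \<and> length as \<noteq> 1} = {}" if "a \<notin> Reg" for a
    using nonregular_factorization_length[OF _ that] by auto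
  have nonreg: "finite_up_to (rearranged_by (assoc_by \<beta>))
      {(u, as). factorization (reg_restrict \<tau>) a u as \<and> length as \<noteq> 1}"
    if "a \<notin> Reg" for a unfolding finite_up_to_def empty[OF that] by simp
  show ?thesis
    unfolding regular_FFR_def FFR_def
    by (rule all_nonunits_iff_all_regular[OF reg nonreg])
qed

section \<open>Antichains of multisets\<close>

text \<open>Dickson's lemma, for multisets. Fix a member \<open>M\<close> of the antichain. Any other member \<open>N\<close> fails to
  contain \<open>M\<close>, so some \<open>c\<close> occurs in \<open>N\<close> less often than in \<open>M\<close>. This leaves finitely many pairs of such
  a \<open>c\<close> and its multiplicity in \<open>N\<close>; for each pair, deleting \<open>c\<close> gives an antichain over one
  element less.\<close>

lemma finite_multiset_antichain:
  assumes "finite C" "\<And>M. M \<in> S \<Longrightarrow> set_mset M \<subseteq> C" "\<And>M N. M \<in> S \<Longrightarrow> N \<in> S \<Longrightarrow> \<not> M \<subset># N"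
  shows "finite S"
  using assms
proof (induction "card C" arbitrary: C S)
  case 0
  then have "S \<subseteq> {{#}}" by auto
  then show ?case by (rule finite_subset) simp
next
  case (Suc n)
  show ?case
  proof (cases "S = {}")
    case False
    then obtain M where M: "M \<in> S" by blast
    define T where "T c k = {N \<in> S. count N c = k}" for c k
    have "finite (T c k)" if c: "c \<in> C" for c k
    proof -
      let ?d = "filter_mset (\<lambda>x. x \<noteq> c)"
      have split: "N = ?d N + replicate_mset k c" if "N \<in> T c k" for N
        using that by (intro multiset_eqI) (auto simp: T_def)
      have "finite (?d ` T c k)"
      proof (rule Suc.hyps(1)[of "C - {c}"])
        show "n = card (C - {c})" using Suc.hyps(2) c by simp
        show "finite (C - {c})" using Suc.prems(1) by simp
        show "set_mset X \<subseteq> C - {c}" if "X \<in> ?d ` T c k" for X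
        proof -
          obtain N where "N \<in> S" "X = ?d N" using \<open>X \<in> ?d ` T c k\<close> by (auto simp: T_def)
          then show ?thesis using Suc.prems(2)[of N] by auto
        qed
        show "\<not> X \<subset># Y" if XY: "X \<in> ?d ` T c k" "Y \<in> ?d ` T c k" for X Y
        proof
          assume less: "X \<subset># Y"
          obtain N N' where N: "N \<in> T c k" "X = ?d N" "N' \<in> T c k" "Y = ?d N'" using XY by blast
          have "N \<subset># N'"
            using less split[OF N(1)] split[OF N(3)] N(2,4)
            by (metis subset_mset.add_less_cancel_right)
          then show False using Suc.prems(3) N by (auto simp: T_def)
        qed
      qed
      moreover have "inj_on ?d (T c k)"
        by (rule inj_onI) (metis split)
      ultimately show ?thesis by (simp add: finite_image_iff)
    qed
    then have fin: "finite (insert M (\<Union>c\<in>C. \<Union>k<count M c. T c k))"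
      using Suc.prems(1) by blast
    have "S \<subseteq> insert M (\<Union>c\<in>C. \<Union>k<count M c. T c k)"
    proof
      fix N assume N: "N \<in> S"
      show "N \<in> insert M (\<Union>c\<in>C. \<Union>k<count M c. T c k)"
      proof (cases "N = M")
        case False
        then have "\<not> M \<subseteq># N" using Suc.prems(3)[OF M N] by (simp add: subset_mset.less_le)
        then obtain c where c: "count N c < count M c"
          by (auto simp: subseteq_mset_def not_le)
        then have "c \<in> C" using Suc.prems(2)[OF M] by (metis count_greater_zero_iff gr_zeroI not_less0 subsetD)
        then show ?thesis using c N by (auto simp: T_def)
      qed simp
    qed
    then show ?thesis using fin by (rule finite_subset)
  qed simp
qed

lemma finite_submultisets: "finite {N. N \<subseteq># M}"
proof (induction M)
  case (add x M)
  have "{N. N \<subseteq># add_mset x M} \<subseteq> {N. N \<subseteq># M} \<union> add_mset x ` {N. N \<subseteq># M}"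
  proof
    fix N assume N: "N \<in> {N. N \<subseteq># add_mset x M}"
    show "N \<in> {N. N \<subseteq># M} \<union> add_mset x ` {N. N \<subseteq># M}"
    proof (cases "x \<in># N")
      case True
      then obtain N' where "N = add_mset x N'" by (meson mset_add)
      then show ?thesis using N by auto
    next
      case False
      have "N - {#x#} \<subseteq># M" using N by (simp add: subset_eq_diff_conv)
      then show ?thesis using False by (simp add: diff_single_trivial)
    qed
  qed
  then show ?case using add by (meson finite_Un finite_imageI finite_subset)
qed simp

section \<open>Class multisets of factorizations\<close>

text \<open>The class of a product depends only on the classes of its factors, so it makes sense to multiply
  out a class multiset.\<close>

lemma principal_prod_cong:
  fixes M N :: "'a::comm_ring_1 multiset"
  assumes "image_mset principal M = image_mset principal N"
  shows "principal (prod_mset M) = principal (prod_mset N)"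
  using assms
proof (induction M arbitrary: N)
  case (add x M)
  obtain y N' where N: "N = add_mset y N'" "principal y = principal x"
      "image_mset principal N' = image_mset principal M"
    using msed_map_invR[of principal N "principal x" "image_mset principal M"] add.prems by auto
  have "principal (prod_mset M) = principal (prod_mset N')" by (rule add.IH[OF N(3)[symmetric]])
  then have "prod_mset M dvd prod_mset N'" "prod_mset N' dvd prod_mset M" "x dvd y" "y dvd x"
    using N(2) unfolding principal_eq_iff_dvd by auto
  then show ?case
    unfolding N(1) principal_eq_iff_dvd prod_mset.add_mset by (intro conjI mult_dvd_mono)
qed simp

text \<open>If the classes of \<open>as\<close> formed a proper part of those of \<open>bs\<close>, then a proper part of \<open>bs\<close> would
  already have product associate to \<open>a\<close>, and cancellation would make the other factors units.\<close>

lemma class_multiset_not_proper: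
  assumes f: "factorization \<sigma> a u as" "factorization \<sigma> a v bs" and a: "a \<in> Reg"
  shows "\<not> class_multiset as \<subset># class_multiset bs"
proof
  assume less: "class_multiset as \<subset># class_multiset bs"
  then obtain D where D: "class_multiset bs = class_multiset as + D"
    by (meson subset_mset.less_imp_le subset_mset.le_iff_add)
  then obtain B B' where B: "mset bs = B + B'" "class_multiset as = image_mset principal B"
      "D = image_mset principal B'"
    using image_mset_eq_plusD[of principal "mset bs"] unfolding class_multiset_def by metis
  have prods: "a = u * prod_list as" "a = v * prod_list bs"
    and units: "ring_unit u" "ring_unit v"
    using f by (auto simp: factorization_def)
  have "principal (prod_mset B) = principal (prod_list as)"
    using principal_prod_cong[of B "mset as"] B(2)
    by (simp add: class_multiset_def prod_mset_prod_list)
  also have "\<dots> = principal a" using prods(1) units(1) by (simp add: principal_unit_mult)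
  finally have "a dvd prod_mset B" by (simp add: principal_eq_iff_dvd)
  then obtain r where r: "prod_mset B = a * r" ..
  have "prod_list bs = prod_mset B * prod_mset B'"
    using B(1) by (metis prod_mset_Un prod_mset_prod_list)
  then have prod_bs: "prod_list bs = (a * r) * prod_mset B'" by (simp only: r)
  have "a * (v * r * prod_mset B') = v * ((a * r) * prod_mset B')" by (simp only: mult_ac)
  also have "\<dots> = v * prod_list bs" by (simp only: prod_bs)
  also have "\<dots> = a * 1" by (simp only: prods(2)[symmetric] mult_1_right)
  finally have "v * r * prod_mset B' = 1" using Reg_cancel[OF a] by blast
  then have unit: "ring_unit (prod_mset B')" using dvd_triv_right[of "prod_mset B'" "v * r"] by simp
  have "B' \<noteq> {#}" using less D B(3) by auto
  then obtain x where x: "x \<in># B'" by blast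
  then have "ring_unit x" using dvd_trans[OF dvd_prod_mset unit] by blast
  moreover have "x \<in> set bs" using x B(1) by (metis set_mset_mset union_iff)
  ultimately show False using factorization_factor_nonunit[OF f(2)] by blast
qed

text \<open>The class multisets of the factorizations in \<open>A\<close> are an antichain over the set of classes of
  their factors.\<close>

lemma finite_class_multisets:
  assumes a: "a \<in> Reg" and A: "\<And>as. as \<in> A \<Longrightarrow> \<exists>u. factorization \<sigma> a u as"
    and fin: "finite (principal ` (\<Union>as\<in>A. set as))"
  shows "finite (class_multiset ` A)"
  using fin
proof (rule finite_multiset_antichain)
  show "set_mset M \<subseteq> principal ` (\<Union>as\<in>A. set as)" if M: "M \<in> class_multiset ` A" for M
  proof -
    obtain as where "as \<in> A" "M = class_multiset as" using M by blast
    then have M: "set_mset M = principal ` set as" by (simp add: class_multiset_def)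
    show ?thesis unfolding M using \<open>as \<in> A\<close> by (intro image_mono UN_upper)
  qed
  show "\<not> M \<subset># N" if "M \<in> class_multiset ` A" "N \<in> class_multiset ` A" for M N
    using that A class_multiset_not_proper[OF _ _ a] by blast
qed

section \<open>Finiteness conditions under refinement\<close>

lemma factorization_classes:
  "(\<lambda>p. class_multiset (snd p)) ` {(u, as). factorization \<tau> a u as} =
   class_multiset ` {as. \<exists>u. factorization \<tau> a u as}"
  by (auto simp: image_iff) (metis snd_conv)

text \<open>Finitely many classes of divisors leave only finitely many class multisets, by the antichain
  property; conversely, each class multiset contains the classes of finitely many divisors.\<close>

lemma regular_WFFR_iff_regular_FFR: "regular_WFFR \<tau> \<longleftrightarrow> regular_FFR \<tau>"
proof -
  have "finite (principal ` {b. divisor \<tau> b a}) \<longleftrightarrow>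
      finite (class_multiset ` {as. \<exists>u. factorization \<tau> a u as})" (is "finite ?P \<longleftrightarrow> finite ?C")
    if a: "a \<in> Reg" for a
  proof
    assume P: "finite ?P"
    have "(\<Union>as\<in>{as. \<exists>u. factorization \<tau> a u as}. set as) = {b. divisor \<tau> b a}"
      by (auto simp: divisor_def)
    with P show "finite ?C" by (intro finite_class_multisets[OF a, of _ \<tau>]) simp_all
  next
    assume "finite ?C"
    moreover have "?P \<subseteq> (\<Union>M\<in>?C. set_mset M)"
    proof
      fix X assume "X \<in> ?P"
      then obtain b u as where "X = principal b" "factorization \<tau> a u as" "b \<in> set as"
        by (auto simp: divisor_def)
      then have "class_multiset as \<in> ?C" "X \<in># class_multiset as"
        by (auto simp: class_multiset_def)
      then show "X \<in> (\<Union>M\<in>?C. set_mset M)" by (rule UN_I)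
    qed
    ultimately show "finite ?P" by (meson finite_UN finite_set_mset finite_subset)
  qed
  then show ?thesis
    unfolding regular_WFFR_def regular_FFR_def finite_up_to_associate
      finite_up_to_rearranged_associate factorization_classes
    by (simp add: Reg_nonunits_def)
qed

lemma refine_factorization:
  assumes "refinable \<tau>" "factorization \<tau> a u as"
    and "\<And>x. x \<in> set as \<Longrightarrow> factorization \<tau> x (g x) (h x)"
  shows "factorization \<tau> a (u * prod_list (map g as)) (concat (map h as))"
proof -
  have "factorization \<tau> a u as \<and> length (map g as) = length as \<and> length (map h as) = length as \<and>
      (\<forall>i<length as. factorization \<tau> (as ! i) (map g as ! i) (map h as ! i))"
    using assms(2,3) by simp
  then show ?thesis
    by (rule assms(1)[unfolded refinable_def, THEN spec, THEN spec, THEN spec, THEN spec, THEN spec,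
        THEN mp])
qed

text \<open>Refining a factorization that contains the divisor \<open>b\<close> displays \<open>b\<close> as a partial product, up to a
  unit, of a factorization into irreducibles. The latter have finitely many class multisets, each of
  these has finitely many submultisets, and a submultiset determines the class of \<open>b\<close>.\<close>

lemma atomic_idf_imp_regular_WFFR:
  assumes ref: "refinable \<tau>" and atomic: "regular_atomic \<tau>" and idf: "regular_idf \<tau>"
  shows "regular_WFFR \<tau>"
  unfolding regular_WFFR_def finite_up_to_associate
proof
  fix a :: 'a assume "a \<in> Reg_nonunits"
  then have a: "a \<in> Reg" by (simp add: Reg_nonunits_def)
  define A where "A = {as. \<exists>u. regular_atomic_factorization \<tau> a u as}"
  have "(\<Union>as\<in>A. set as) \<subseteq> {b. divisor \<tau> b a \<and> regular_irreducible \<tau> b}"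
    by (auto simp: A_def divisor_def regular_atomic_factorization_def regular_factorization_def)
  moreover have "finite (principal ` {b. divisor \<tau> b a \<and> regular_irreducible \<tau> b})"
    using idf \<open>a \<in> Reg_nonunits\<close> by (simp add: regular_idf_def finite_up_to_associate)
  ultimately have "finite (principal ` (\<Union>as\<in>A. set as))" by (meson finite_subset image_mono)
  then have finA: "finite (class_multiset ` A)"
    using finite_class_multisets[OF a, of A \<tau>]
    by (auto simp: A_def regular_atomic_factorization_def regular_factorization_def)
  \<comment> \<open>The class of the product of any elements with the given classes.\<close>
  define F :: "'a set multiset \<Rightarrow> 'a set" where
    "F K = principal (prod_mset (image_mset (\<lambda>X. SOME x. principal x = X) K))" for K
  have F: "F (class_multiset xs) = principal (prod_list xs)" for xs
  proof -
    have "principal (SOME x. principal x = principal b) = principal b" for b :: 'a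
      by (rule someI[of _ b]) simp
    then show ?thesis
      using principal_prod_cong[of "image_mset (\<lambda>X. SOME x. principal x = X) (class_multiset xs)" "mset xs"]
      by (simp add: F_def class_multiset_def multiset.map_comp comp_def prod_mset_prod_list)
  qed
  have "principal ` {b. divisor \<tau> b a} \<subseteq> F ` (\<Union>K\<in>class_multiset ` A. {N. N \<subseteq># K})"
  proof
    fix X assume "X \<in> principal ` {b. divisor \<tau> b a}"
    then obtain b u as where b: "X = principal b" and f: "factorization \<tau> a u as" "b \<in> set as"
      by (auto simp: divisor_def)
    have "\<exists>v bs. regular_atomic_factorization \<tau> x v bs" if "x \<in> set as" for x
      using atomic factorization_factor_Reg[OF f(1) a that] factorization_factor_nonunit[OF f(1) that]
      by (simp add: regular_atomic_def Reg_nonunits_def)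
    then obtain g h where gh: "\<And>x. x \<in> set as \<Longrightarrow> regular_atomic_factorization \<tau> x (g x) (h x)"
      by metis
    have fx: "factorization \<tau> x (g x) (h x)" if "x \<in> set as" for x
      using gh[OF that] by (simp add: regular_atomic_factorization_def regular_factorization_def)
    then have "factorization \<tau> a (u * prod_list (map g as)) (concat (map h as))"
      using refine_factorization[OF ref f(1)] by blast
    then have inA: "concat (map h as) \<in> A"
      using gh a by (auto simp: A_def regular_atomic_factorization_def regular_factorization_def)
    obtain ys zs where "as = ys @ b # zs" using f(2) by (meson split_list)
    then have "class_multiset (h b) \<subseteq># class_multiset (concat (map h as))"
      by (simp add: class_multiset_def)
    moreover have "X = F (class_multiset (h b))"
      using fx[OF f(2)] b by (simp add: F factorization_def) (metis principal_unit_mult)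
    ultimately show "X \<in> F ` (\<Union>K\<in>class_multiset ` A. {N. N \<subseteq># K})" using inA by blast
  qed
  moreover have "finite (\<Union>K\<in>class_multiset ` A. {N. N \<subseteq># K})"
    using finA finite_submultisets by blast
  ultimately show "finite (principal ` {b. divisor \<tau> b a})"
    by (meson finite_imageI finite_subset)
qed

text \<open>A reducible factor could be replaced by a non-trivial factorization of it, so a factorization of
  maximal length consists of irreducibles.\<close>

lemma regular_FFR_imp_regular_atomic:
  assumes ref: "refinable \<tau>" and ffr: "regular_FFR \<tau>"
  shows "regular_atomic \<tau>"
  unfolding regular_atomic_def
proof
  fix a :: 'a assume an: "a \<in> Reg_nonunits"
  then have a: "a \<in> Reg" "\<not> ring_unit a" by (simp_all add: Reg_nonunits_def)
  define P where "P as \<longleftrightarrow> (\<exists>u. factorization \<tau> a u as)" for as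
  have "finite (class_multiset ` {as. P as})"
    using ffr an
    by (simp add: regular_FFR_def finite_up_to_rearranged_associate factorization_classes P_def)
  then have "finite (size ` class_multiset ` {as. P as})" by (rule finite_imageI)
  then have "finite (length ` {as. P as})" by (simp add: image_image class_multiset_def)
  then obtain B where "\<forall>n\<in>length ` {as. P as}. n \<le> B" by (meson finite_nat_set_iff_bounded_le)
  then have bound: "\<forall>as. P as \<longrightarrow> length as < Suc B" by (auto simp: less_Suc_eq_le)
  have "P [a]" using factorization_self[OF a(2)] by (auto simp: P_def)
  then have "\<exists>as. P as \<and> (\<forall>bs. P bs \<longrightarrow> length bs \<le> length as)"
    using bound by (rule Lattices_Big.ex_has_greatest_nat)
  then obtain as where as: "P as" and max: "\<forall>bs. P bs \<longrightarrow> length bs \<le> length as"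
    by (elim exE conjE)
  obtain u where f: "factorization \<tau> a u as" using as by (auto simp: P_def)
  have "regular_irreducible \<tau> x" if x: "x \<in> set as" for x
  proof (rule ccontr)
    assume red: "\<not> regular_irreducible \<tau> x"
    have "x \<in> Reg" "\<not> ring_unit x"
      using factorization_factor_Reg[OF f a(1) x] factorization_factor_nonunit[OF f x] .
    then obtain v cs where cs: "factorization \<tau> x v cs" "\<forall>c\<in>set cs. \<not> associate x c"
      using red by (auto simp: regular_irreducible_def Reg_nonunits_def regular_factorization_def)
    have "cs \<noteq> [c]" for c
      using cs by (auto simp: factorization_singleton associate_def principal_unit_mult)
    moreover have "cs \<noteq> []" using cs(1) by (simp add: factorization_def)
    ultimately have len: "length cs \<ge> 2" by (cases cs; cases "tl cs") auto
    \<comment> \<open>Replace every occurrence of \<open>x\<close> by \<open>v * prod_list cs\<close>, and keep the other factors.\<close>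
    define g where "g y = (if y = x then v else 1)" for y
    define h where "h y = (if y = x then cs else [y])" for y
    have "factorization \<tau> y (g y) (h y)" if "y \<in> set as" for y
      using cs(1) factorization_factor_nonunit[OF f that]
      by (simp add: g_def h_def factorization_self)
    then have "P (concat (map h as))" using refine_factorization[OF ref f] by (auto simp: P_def)
    then have le: "length (concat (map h as)) \<le> length as"
      by (rule max[THEN spec, THEN mp])
    have ge: "length (concat (map h zs)) \<ge> length zs" for zs
      using len by (induction zs) (auto simp: h_def)
    obtain ys zs where "as = ys @ x # zs" using x by (meson split_list)
    then have "length (concat (map h as)) > length as"
      using ge[of ys] ge[of zs] len by (simp add: h_def)
    then show False using le by simp
  qed
  then show "\<exists>u as. regular_atomic_factorization \<tau> a u as"
    using f a(1) by (auto simp: regular_atomic_factorization_def regular_factorization_def)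
qed

lemma regular_WFFR_imp_regular_idf: "regular_WFFR \<tau> \<Longrightarrow> regular_idf \<tau>"
  unfolding regular_WFFR_def regular_idf_def finite_up_to_associate
  by (metis (no_types, lifting) Collect_mono finite_subset image_mono)

lemma refinable_atomic_idf_iff_regular_WFFR:
  assumes "refinable \<tau>"
  shows "regular_atomic \<tau> \<and> regular_idf \<tau> \<longleftrightarrow> regular_WFFR \<tau>"
  using atomic_idf_imp_regular_WFFR[OF assms] regular_FFR_imp_regular_atomic[OF assms]
    regular_WFFR_imp_regular_idf regular_WFFR_iff_regular_FFR by blast

theorem theorem4p8:
  fixes \<tau> :: "('a::comm_ring_1 \<times> 'a) set"
    and \<alpha> :: atom_kind and \<beta> :: assoc_kind
  assumes "\<tau> \<subseteq> nonzero_nonunits \<times> nonzero_nonunits"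
    and "sym \<tau>"
  shows "(regular_ACCP \<tau> \<longleftrightarrow> ACCP (reg_restrict \<tau>)) \<and>
    (regular_UFR \<tau> \<longleftrightarrow> UFR \<alpha> \<beta> (reg_restrict \<tau>)) \<and>
    (regular_HFR \<tau> \<longleftrightarrow> HFR \<alpha> (reg_restrict \<tau>)) \<and>
    (regular_BFR \<tau> \<longleftrightarrow> BFR (reg_restrict \<tau>)) \<and>
    (regular_idf \<tau> \<longleftrightarrow> df_ring \<alpha> \<beta> (reg_restrict \<tau>)) \<and>
    (regular_atomic \<tau> \<and> regular_idf \<tau> \<longleftrightarrow>
       atomic_ring \<alpha> (reg_restrict \<tau>) \<and> df_ring \<alpha> \<beta> (reg_restrict \<tau>)) \<and>
    (regular_WFFR \<tau> \<longleftrightarrow> WFFR \<beta> (reg_restrict \<tau>)) \<and>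
    (regular_FFR \<tau> \<longleftrightarrow> FFR \<beta> (reg_restrict \<tau>)) \<and>
    (refinable \<tau> \<longrightarrow>
       (regular_atomic \<tau> \<and> regular_idf \<tau> \<longleftrightarrow> regular_WFFR \<tau>) \<and>
       (regular_WFFR \<tau> \<longleftrightarrow> regular_FFR \<tau>) \<and>
       (atomic_ring \<alpha> (reg_restrict \<tau>) \<and> df_ring \<alpha> \<beta> (reg_restrict \<tau>) \<longleftrightarrow>
          WFFR \<beta> (reg_restrict \<tau>)) \<and>
       (WFFR \<beta> (reg_restrict \<tau>) \<longleftrightarrow> FFR \<beta> (reg_restrict \<tau>)))"
proof -
  note iffs = regular_ACCP_iff_ACCP[of \<tau>] regular_UFR_iff_UFR[of \<tau> \<alpha> \<beta>] regular_HFR_iff_HFR[of \<tau> \<alpha>]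
    regular_BFR_iff_BFR[of \<tau>] regular_idf_iff_df_ring[of \<tau> \<alpha> \<beta>]
    regular_atomic_iff_atomic_ring[of \<tau> \<alpha>] regular_WFFR_iff_WFFR[of \<tau> \<beta>]
    regular_FFR_iff_FFR[of \<tau> \<beta>]
  show ?thesis
    using iffs refinable_atomic_idf_iff_regular_WFFR[of \<tau>] regular_WFFR_iff_regular_FFR[of \<tau>]
    by blast
qed

end
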